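(* Let $\mathcal{C}$ be a finite nonempty set of agents (CMAs). For each $i\in\mathcal{C}$ let $\gamma_i>0$ and let $\underline{P}_i\le P_i^0\le\overline{P}_i$ be real numbers. Let $\pi,\widetilde{P}\in\mathbb{R}$, and set $$P_t^0=\sum_{i\in\mathcal{C}}P_i^0,\qquad \overline{P}_t=\sum_{i\in\mathcal{C}}\overline{P}_i,\qquad \gamma_t=\sum_{i\in\mathcal{C}}\frac{1}{\gamma_i}.$$ Assume $P_t^0<\widetilde{P}\le\overline{P}_t$, and that $P_t^0$ and $\widetilde{P}$ are nonzero and have the same sign. Define $$\mu^*=\frac{\pi\widetilde{P}}{P_t^0}-\frac{2(\widetilde{P}-P_t^0)^2}{\gamma_tP_t^0},\qquad \widetilde{\mu}^*=\frac{\widetilde{P}\left(2(\widetilde{P}-P_t^0)-\pi\gamma_t\right)}{\gamma_tP_t^0},\qquad P_i^*=P_i^0+\frac{\widetilde{\mu}^*+\mu^*}{2\gamma_i}\quad(i\in\mathcal{C}),$$ and assume that $\mu^*+\widetilde{\mu}^*<2\gamma_i(\overline{P}_i-P_i^0)$ for all $i\in\mathcal{C}$. Then: 1. At the prices $(\mu^*,\widetilde{\mu}^* )$, the bid profile $(P_i^* )_{i\in\mathcal{C}}$ is a Nash equilibrium among the CMAs, and it is the only one. 2. The tuple $\left((P_i^* )_{i\in\mathcal{C}},\mu^*,\widetilde{\mu}^*\right)$ is a Stackelberg equilibrium between the operator (CMO, leader) and the CMAs (followers), and it is the only one.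
   Context: Market game at a single market-clearing time. The leader (consumer market operator, CMO) announces an electricity price $\mu\in\mathbb{R}$ and a flexibility price $\widetilde{\mu}\in\mathbb{R}$, common to all agents. Each follower $i\in\mathcal{C}$ (consumer market agent, CMA) then bids a net power injection $P_i$. Here $P_i^0$ is the baseline injection of CMA $i$, $[\underline{P}_i,\overline{P}_i]$ is its feasible flexibility range, $\gamma_i$ is its disutility parameter, $\pi$ is the price set by the upper-level market, and $\widetilde{P}$ is the total injection setpoint requested by the upper-level market. CMA problem: the strategy set of CMA $i$ is $S_i=\{P_i\in\mathbb{R}:\underline{P}_i\le P_i\le\overline{P}_i,\ P_i\ge P_i^0\}$ (only upward flexibility is requested). Its payoff, to be maximized, is $$U_i^{cma}(P_i,\widetilde{\mu},\mu)=\widetilde{\mu}(P_i-P_i^0)+\mu P_i-\gamma_i(P_i-P_i^0)^2.$$ Nash equilibrium among the CMAs at prices $(\mu,\widetilde{\mu})$: a profile $(P_i)_{i\in\mathcal{C}}$ with $P_i\in S_i$ for all $i$ and $U_i^{cma}(P_i,\widetilde{\mu},\mu)\ge U_i^{cma}(P_i',\widetilde{\mu},\mu)$ for all $i\in\mathcal{C}$ and all $P_i'\in S_i$, with the prices held fixed. CMO problem: the payoff of the CMO, to be maximized, is $$U^{cmo}\left((P_i)_{i\in\mathcal{C}},\mu,\widetilde{\mu}\right)=-\Big(\sum_{i\in\mathcal{C}}P_i-\widetilde{P}\Big)^2.$$ A tuple $\left((P_i)_{i\in\mathcal{C}},\mu,\widetilde{\mu}\right)$ is called admissible if: (a) $(P_i)_{i\in\mathcal{C}}$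 is a Nash equilibrium among the CMAs at prices $(\mu,\widetilde{\mu})$; (b) the budget balance $\widetilde{\mu}\sum_{i\in\mathcal{C}}(P_i-P_i^0)+\mu\sum_{i\in\mathcal{C}}P_i=\pi\sum_{i\in\mathcal{C}}P_i$ holds; (c) $\mu+\widetilde{\mu}<2\gamma_i(\overline{P}_i-P_i^0)$ for all $i\in\mathcal{C}$ (the CMO always sets prices satisfying this condition). Stackelberg equilibrium: an admissible tuple whose value of $U^{cmo}$ is at least that of every other admissible tuple. *)

theory Defs
  imports Complex_Main "HOL-Library.FuncSet"
begin

text \<open>
  Parameters: \<open>C\<close> is the set of followers (CMAs), \<open>Pmin i\<close> and \<open>Pmax i\<close> bound the feasible range
  of CMA \<open>i\<close>, \<open>P0 i\<close> is its baseline injection, \<open>\<gamma> i\<close> its disutility parameter, \<open>\<pi>\<close> the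
  upper-level price and \<open>Preq\<close> the requested total injection. The prices announced by the leader
  (CMO) are \<open>\<mu>\<close> (electricity) and \<open>\<mu>f\<close> (flexibility).

  A profile \<open>(P\<^sub>i)\<^sub>i\<close> over \<open>C\<close> is an extensional function on \<open>C\<close>, that is, \<open>undefined\<close> outside
  \<open>C\<close>, so that equality of functions is equality of profiles.
\<close>

definition cma_strategies ::
  "('i \<Rightarrow> real) \<Rightarrow> ('i \<Rightarrow> real) \<Rightarrow> ('i \<Rightarrow> real) \<Rightarrow> 'i \<Rightarrow> real set" where
  "cma_strategies Pmin P0 Pmax i = {p. Pmin i \<le> p \<and> p \<le> Pmax i \<and> p \<ge> P0 i}"

definition cma_payoff ::
  "('i \<Rightarrow> real) \<Rightarrow> ('i \<Rightarrow> real) \<Rightarrow> 'i \<Rightarrow> real \<Rightarrow> real \<Rightarrow> real \<Rightarrow> real" where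
  "cma_payoff P0 \<gamma> i p \<mu>f \<mu> = \<mu>f * (p - P0 i) + \<mu> * p - \<gamma> i * (p - P0 i)\<^sup>2"

definition cma_nash ::
  "'i set \<Rightarrow> ('i \<Rightarrow> real) \<Rightarrow> ('i \<Rightarrow> real) \<Rightarrow> ('i \<Rightarrow> real) \<Rightarrow> ('i \<Rightarrow> real) \<Rightarrow>
   real \<Rightarrow> real \<Rightarrow> ('i \<Rightarrow> real) \<Rightarrow> bool" where
  "cma_nash C Pmin P0 Pmax \<gamma> \<mu> \<mu>f P \<longleftrightarrow>
     P \<in> (\<Pi>\<^sub>E i\<in>C. cma_strategies Pmin P0 Pmax i) \<and>
     (\<forall>i\<in>C. \<forall>p'\<in>cma_strategies Pmin P0 Pmax i.
        cma_payoff P0 \<gamma> i (P i) \<mu>f \<mu> \<ge> cma_payoff P0 \<gamma> i p' \<mu>f \<mu>)"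

definition cmo_payoff ::
  "'i set \<Rightarrow> real \<Rightarrow> ('i \<Rightarrow> real) \<times> real \<times> real \<Rightarrow> real" where
  "cmo_payoff C Preq = (\<lambda>(P, \<mu>, \<mu>f). - ((\<Sum>i\<in>C. P i) - Preq)\<^sup>2)"

definition admissible ::
  "'i set \<Rightarrow> ('i \<Rightarrow> real) \<Rightarrow> ('i \<Rightarrow> real) \<Rightarrow> ('i \<Rightarrow> real) \<Rightarrow> ('i \<Rightarrow> real) \<Rightarrow> real \<Rightarrow>
   ('i \<Rightarrow> real) \<times> real \<times> real \<Rightarrow> bool" where
  "admissible C Pmin P0 Pmax \<gamma> \<pi> = (\<lambda>(P, \<mu>, \<mu>f).
     cma_nash C Pmin P0 Pmax \<gamma> \<mu> \<mu>f P \<and>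
     \<mu>f * (\<Sum>i\<in>C. P i - P0 i) + \<mu> * (\<Sum>i\<in>C. P i) = \<pi> * (\<Sum>i\<in>C. P i) \<and>
     (\<forall>i\<in>C. \<mu> + \<mu>f < 2 * \<gamma> i * (Pmax i - P0 i)))"

definition stackelberg ::
  "'i set \<Rightarrow> ('i \<Rightarrow> real) \<Rightarrow> ('i \<Rightarrow> real) \<Rightarrow> ('i \<Rightarrow> real) \<Rightarrow> ('i \<Rightarrow> real) \<Rightarrow> real \<Rightarrow> real \<Rightarrow>
   ('i \<Rightarrow> real) \<times> real \<times> real \<Rightarrow> bool" where
  "stackelberg C Pmin P0 Pmax \<gamma> \<pi> Preq t \<longleftrightarrow>
     admissible C Pmin P0 Pmax \<gamma> \<pi> t \<and>
     (\<forall>t'. admissible C Pmin P0 Pmax \<gamma> \<pi> t' \<longrightarrow> cmo_payoff C Preq t \<ge> cmo_payoff C Preq t')"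

end

(*
  With s = \<mu> + \<mu>f, the payoff of follower i is s x - \<gamma>\<^sub>i x^2 up to a constant, where x = p - P0\<^sub>i \<ge> 0.
  Strict concavity makes x = max 0 s / (2 \<gamma>\<^sub>i) the only best response, so the total injection is
  P0t + \<gamma>t max 0 s / 2. The payoff of the leader is at most 0, and it is 0 exactly when
  s = 2 (Preq - P0t) / \<gamma>t. For this s the budget balance is a linear equation in \<mu> with leading
  coefficient P0t, which is nonzero, so both prices are determined.
*)
theory Submission
  imports Defs
begin

text \<open>Here \<open>s\<close> stands for the price sum \<open>\<mu> + \<mu>f\<close>. The
  clipping at 0 accounts for the constraint \<open>p \<ge> P0 i\<close>; there is no clipping at
  \<open>Pmax i\<close>, because the price condition (c) keeps the bid below it.\<close>

definition best_response :: "real \<Rightarrow> real \<Rightarrow> real \<Rightarrow> real" where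
  "best_response p0 g s = p0 + max 0 s / (2 * g)"

lemma best_response_mem:
  assumes "\<gamma> i > 0" and "Pmin i \<le> P0 i" and "P0 i \<le> Pmax i"
    and "s < 2 * \<gamma> i * (Pmax i - P0 i)"
  shows "best_response (P0 i) (\<gamma> i) s \<in> cma_strategies Pmin P0 Pmax i"
proof -
  have "max 0 s \<le> (Pmax i - P0 i) * (2 * \<gamma> i)"
    using assms by (simp add: mult_ac)
  then have "max 0 s / (2 * \<gamma> i) \<le> Pmax i - P0 i"
    using assms(1) by (simp add: pos_divide_le_eq)
  moreover have "0 \<le> max 0 s / (2 * \<gamma> i)"
    using assms(1) by simp
  ultimately show ?thesis
    using assms(2) unfolding best_response_def cma_strategies_def mem_Collect_eq by linarith
qed

text \<open>Strong concavity in quantitative form: the quadratic loss term yields optimality and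
  uniqueness of the best response at once.\<close>

lemma cma_payoff_gap:
  assumes g: "\<gamma> i > 0" and p: "P0 i \<le> p"
  shows "cma_payoff P0 \<gamma> i p \<mu>f \<mu> + \<gamma> i * (p - best_response (P0 i) (\<gamma> i) (\<mu> + \<mu>f))\<^sup>2
    \<le> cma_payoff P0 \<gamma> i (best_response (P0 i) (\<gamma> i) (\<mu> + \<mu>f)) \<mu>f \<mu>"
proof -
  define s where "s = \<mu> + \<mu>f"
  define q where "q = max 0 s / (2 * \<gamma> i)"
  define x where "x = p - P0 i"
  have r: "2 * \<gamma> i * q = max 0 s"
    using g by (simp add: q_def)
  \<comment> \<open>Complementary slackness: \<open>2 * \<gamma> i * q - s = max 0 s - s\<close> is
    the multiplier of the constraint \<open>x \<ge> 0\<close>. It vanishes for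
    \<open>s \<ge> 0\<close>, and \<open>q\<close> vanishes otherwise.\<close>
  have sq: "(2 * \<gamma> i * q - s) * q = 0"
    unfolding r by (auto simp: q_def max_def)
  have sx: "0 \<le> (2 * \<gamma> i * q - s) * x"
    unfolding r using p by (intro mult_nonneg_nonneg) (auto simp: x_def)
  have pq: "p - (P0 i + q) = x - q" "p = P0 i + x" "\<mu> = s - \<mu>f"
    by (auto simp: x_def s_def)
  have "cma_payoff P0 \<gamma> i (P0 i + q) \<mu>f \<mu>
      - (cma_payoff P0 \<gamma> i p \<mu>f \<mu> + \<gamma> i * (p - (P0 i + q))\<^sup>2)
    = (2 * \<gamma> i * q - s) * x - (2 * \<gamma> i * q - s) * q"
    unfolding pq(1) unfolding cma_payoff_def pq(2,3) by (simp add: power2_eq_square algebra_simps)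
  then show ?thesis
    using sq sx unfolding best_response_def s_def[symmetric] q_def[symmetric] by linarith
qed

text \<open>At fixed prices each payoff depends only on the agent's own bid, so the game splits into
  separate maximizations, each settled by \<open>cma_payoff_gap\<close>.\<close>

lemma cma_nash_iff:
  assumes g: "\<And>i. i \<in> C \<Longrightarrow> \<gamma> i > 0"
    and b: "\<And>i. i \<in> C \<Longrightarrow> Pmin i \<le> P0 i \<and> P0 i \<le> Pmax i"
    and c: "\<And>i. i \<in> C \<Longrightarrow> \<mu> + \<mu>f < 2 * \<gamma> i * (Pmax i - P0 i)"
  shows "cma_nash C Pmin P0 Pmax \<gamma> \<mu> \<mu>f P \<longleftrightarrow>
    P = (\<lambda>i\<in>C. best_response (P0 i) (\<gamma> i) (\<mu> + \<mu>f))" (is "?N \<longleftrightarrow> P = ?B")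
proof
  let ?b = "\<lambda>i. best_response (P0 i) (\<gamma> i) (\<mu> + \<mu>f)"
  have mem: "?b i \<in> cma_strategies Pmin P0 Pmax i" if "i \<in> C" for i
    using that g b c by (intro best_response_mem) auto
  show "P = ?B" if ?N
  proof (rule extensionalityI[of P C])
    show "P \<in> extensional C" "?B \<in> extensional C"
      using that by (auto simp: cma_nash_def PiE_def)
    fix i assume i: "i \<in> C"
    have "P0 i \<le> P i"
      using that i by (auto simp: cma_nash_def cma_strategies_def PiE_def Pi_def)
    from cma_payoff_gap[of \<gamma> i P0, OF g[OF i] this, of \<mu>f \<mu>]
    have "cma_payoff P0 \<gamma> i (P i) \<mu>f \<mu> + \<gamma> i * (P i - ?b i)\<^sup>2 \<le> cma_payoff P0 \<gamma> i (?b i) \<mu>f \<mu>" .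
    also have "\<dots> \<le> cma_payoff P0 \<gamma> i (P i) \<mu>f \<mu>"
      using that i mem by (auto simp: cma_nash_def)
    \<comment> \<open>The best response is itself a feasible deviation, so the gap at an equilibrium
      bid leaves no room for a positive square.\<close>
    finally have "(P i - ?b i)\<^sup>2 \<le> 0"
      using g[OF i] by (simp add: mult_le_0_iff)
    then show "P i = ?B i"
      using i by simp
  qed
  show ?N if "P = ?B"
    unfolding cma_nash_def
  proof (intro conjI ballI)
    show "P \<in> (\<Pi>\<^sub>E i\<in>C. cma_strategies Pmin P0 Pmax i)"
      using mem that by auto
    fix i p assume i: "i \<in> C" and "p \<in> cma_strategies Pmin P0 Pmax i"
    then have "P0 i \<le> p"
      by (simp add: cma_strategies_def)
    from cma_payoff_gap[of \<gamma> i P0, OF g[OF i] this, of \<mu>f \<mu>]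
    have "cma_payoff P0 \<gamma> i p \<mu>f \<mu> + \<gamma> i * (p - ?b i)\<^sup>2 \<le> cma_payoff P0 \<gamma> i (?b i) \<mu>f \<mu>" .
    moreover have "0 \<le> \<gamma> i * (p - ?b i)\<^sup>2"
      using g[OF i] by simp
    ultimately show "cma_payoff P0 \<gamma> i p \<mu>f \<mu> \<le> cma_payoff P0 \<gamma> i (P i) \<mu>f \<mu>"
      using that i by simp
  qed
qed

lemma sum_best_response:
  "(\<Sum>i\<in>C. best_response (P0 i) (\<gamma> i) s) = (\<Sum>i\<in>C. P0 i) + max 0 s / 2 * (\<Sum>i\<in>C. 1 / \<gamma> i)"
  by (simp add: best_response_def sum.distrib sum_distrib_left)

theorem theorem1:
  fixes C :: "'i set"
    and Pmin P0 Pmax \<gamma> :: "'i \<Rightarrow> real"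
    and \<pi> Preq P0t Pmaxt \<gamma>t \<mu>s \<mu>fs :: real
    and Ps :: "'i \<Rightarrow> real"
  assumes "finite C" and "C \<noteq> {}"
    and "\<And>i. i \<in> C \<Longrightarrow> \<gamma> i > 0"
    and "\<And>i. i \<in> C \<Longrightarrow> Pmin i \<le> P0 i \<and> P0 i \<le> Pmax i"
    and "P0t = (\<Sum>i\<in>C. P0 i)"
    and "Pmaxt = (\<Sum>i\<in>C. Pmax i)"
    and "\<gamma>t = (\<Sum>i\<in>C. 1 / \<gamma> i)"
    and "P0t < Preq" and "Preq \<le> Pmaxt"
    and "P0t \<noteq> 0" and "Preq \<noteq> 0" and "sgn P0t = sgn Preq"
    and "\<mu>s = \<pi> * Preq / P0t - 2 * (Preq - P0t)\<^sup>2 / (\<gamma>t * P0t)"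
    and "\<mu>fs = Preq * (2 * (Preq - P0t) - \<pi> * \<gamma>t) / (\<gamma>t * P0t)"
    and "Ps = (\<lambda>i\<in>C. P0 i + (\<mu>fs + \<mu>s) / (2 * \<gamma> i))"
    and "\<And>i. i \<in> C \<Longrightarrow> \<mu>s + \<mu>fs < 2 * \<gamma> i * (Pmax i - P0 i)"
  shows "(cma_nash C Pmin P0 Pmax \<gamma> \<mu>s \<mu>fs Ps \<and>
          (\<forall>P. cma_nash C Pmin P0 Pmax \<gamma> \<mu>s \<mu>fs P \<longrightarrow> P = Ps)) \<and>
         (stackelberg C Pmin P0 Pmax \<gamma> \<pi> Preq (Ps, \<mu>s, \<mu>fs) \<and>
          (\<forall>t. stackelberg C Pmin P0 Pmax \<gamma> \<pi> Preq t \<longrightarrow> t = (Ps, \<mu>s, \<mu>fs)))"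
proof -
  note g = assms(3) and b = assms(4) and cs = assms(16)
  define D where "D = Preq - P0t"
  have D: "D > 0" and Preq: "Preq = P0t + D"
    using assms(8) by (simp_all add: D_def)
  have gt: "\<gamma>t > 0"
    unfolding assms(7) using assms(1-3) by (intro sum_pos) auto
  have P0t: "P0t \<noteq> 0"
    by fact
  have \<mu>s: "\<mu>s * (\<gamma>t * P0t) = \<pi> * Preq * \<gamma>t - 2 * D\<^sup>2"
    unfolding assms(13) D_def[symmetric] left_diff_distrib using gt P0t by simp
  have \<mu>fs: "\<mu>fs * (\<gamma>t * P0t) = Preq * (2 * D - \<pi> * \<gamma>t)"
    unfolding assms(14) D_def[symmetric] using gt P0t by simp
  \<comment> \<open>Adding the two price equations cancels the terms in \<open>\<pi>\<close> and
    leaves \<open>2 * D * (Preq - D)\<close>.\<close>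
  have "((\<mu>s + \<mu>fs) * \<gamma>t) * P0t = (2 * D) * P0t"
    using \<mu>s \<mu>fs Preq by algebra
  then have s: "\<mu>s + \<mu>fs = 2 * D / \<gamma>t"
    using gt P0t by (simp add: eq_divide_eq)
  then have s_pos: "\<mu>s + \<mu>fs > 0"
    using D gt by simp
  \<comment> \<open>The positive price sum makes the clipping inactive.\<close>
  have Ps: "Ps = (\<lambda>i\<in>C. best_response (P0 i) (\<gamma> i) (\<mu>s + \<mu>fs))"
    unfolding assms(15) best_response_def using s_pos
    by (intro restrict_ext) (simp add: add.commute)
  have nash: "cma_nash C Pmin P0 Pmax \<gamma> \<mu>s \<mu>fs P \<longleftrightarrow> P = Ps" for P
    unfolding Ps using g b cs by (rule cma_nash_iff)
  have total: "(\<Sum>i\<in>C. best_response (P0 i) (\<gamma> i) s) = P0t + max 0 s / 2 * \<gamma>t" for s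
    unfolding sum_best_response assms(5,7) ..
  have sum_Ps: "(\<Sum>i\<in>C. Ps i) = Preq"
    unfolding Ps using total[of "\<mu>s + \<mu>fs"] s s_pos gt by (simp add: Preq)
  have payoff_Ps: "cmo_payoff C Preq (Ps, \<mu>s, \<mu>fs) = 0"
    by (simp add: cmo_payoff_def sum_Ps)
  have budget: "\<mu>fs * (\<Sum>i\<in>C. Ps i - P0 i) + \<mu>s * (\<Sum>i\<in>C. Ps i) = \<pi> * (\<Sum>i\<in>C. Ps i)"
  proof -
    have "(\<mu>fs * D + \<mu>s * Preq) * (\<gamma>t * P0t) = (\<pi> * Preq) * (\<gamma>t * P0t)"
      using \<mu>s \<mu>fs Preq by algebra
    then show ?thesis
      unfolding sum_subtractf sum_Ps assms(5)[symmetric] D_def[symmetric] using gt P0t by simp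
  qed
  have adm: "admissible C Pmin P0 Pmax \<gamma> \<pi> (Ps, \<mu>s, \<mu>fs)"
    using nash budget cs by (simp add: admissible_def)
  have stack: "stackelberg C Pmin P0 Pmax \<gamma> \<pi> Preq (Ps, \<mu>s, \<mu>fs)"
    unfolding stackelberg_def payoff_Ps using adm by (auto simp: cmo_payoff_def)
  have "(P, \<mu>, \<mu>f) = (Ps, \<mu>s, \<mu>fs)"
    if t: "stackelberg C Pmin P0 Pmax \<gamma> \<pi> Preq (P, \<mu>, \<mu>f)" for P \<mu> \<mu>f
  proof -
    \<comment> \<open>Any equilibrium must do at least as well as the admissible starred tuple,
      whose payoff is the maximal value 0.\<close>
    from t adm have "cmo_payoff C Preq (P, \<mu>, \<mu>f) \<ge> 0"
      unfolding stackelberg_def payoff_Ps[symmetric] by blast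
    then have sum_P: "(\<Sum>i\<in>C. P i) = Preq"
      by (simp add: cmo_payoff_def)
    have c: "\<mu> + \<mu>f < 2 * \<gamma> i * (Pmax i - P0 i)" if "i \<in> C" for i
      using t that by (simp add: stackelberg_def admissible_def)
    have "cma_nash C Pmin P0 Pmax \<gamma> \<mu> \<mu>f P"
      using t by (simp add: stackelberg_def admissible_def)
    then have P: "P = (\<lambda>i\<in>C. best_response (P0 i) (\<gamma> i) (\<mu> + \<mu>f))"
      using cma_nash_iff[of C \<gamma> Pmin P0 Pmax \<mu> \<mu>f P, OF g b c] by blast
    have "max 0 (\<mu> + \<mu>f) / 2 * \<gamma>t = D"
      using sum_P total[of "\<mu> + \<mu>f"] by (simp add: P Preq)
    \<comment> \<open>A nonpositive price sum would give total response 0, contradicting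
      \<open>D > 0\<close>; on positive sums the clipped map is injective.\<close>
    then have s': "\<mu> + \<mu>f = \<mu>s + \<mu>fs"
      unfolding s using D gt by (cases "\<mu> + \<mu>f \<le> 0") (auto simp: eq_divide_eq)
    then have "P = Ps"
      by (simp add: P Ps)
    have "\<mu>f * (\<Sum>i\<in>C. P i - P0 i) + \<mu> * (\<Sum>i\<in>C. P i) = \<pi> * (\<Sum>i\<in>C. P i)"
      using t by (simp add: stackelberg_def admissible_def)
    with budget have "\<mu>f * D + \<mu> * Preq = \<mu>fs * D + \<mu>s * Preq"
      unfolding \<open>P = Ps\<close> sum_subtractf sum_Ps assms(5)[symmetric] D_def by simp
    \<comment> \<open>Subtracting the two budget balances and splitting \<open>Preq\<close> as
      \<open>P0t + D\<close> isolates the difference of the price sums, already known to be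
      0.\<close>
    then have "(\<mu> - \<mu>s) * P0t + (\<mu> + \<mu>f - (\<mu>s + \<mu>fs)) * D = 0"
      by (simp add: Preq algebra_simps)
    with s' P0t have "\<mu> = \<mu>s"
      by simp
    with s' \<open>P = Ps\<close> show ?thesis
      by simp
  qed
  then have "\<forall>t. stackelberg C Pmin P0 Pmax \<gamma> \<pi> Preq t \<longrightarrow> t = (Ps, \<mu>s, \<mu>fs)"
    by (metis prod_cases3)
  with nash stack show ?thesis
    by blast
qed

end
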